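(* Let $[\alpha,\beta]\subset[0,1]$, $\epsilon>0$ and let $n\ge 1$ be an integer. Let $U(u)=u$ for $u\in[0,1]$ and let $U_n$ be the empirical CDF built from $n$ i.i.d. samples from the uniform distribution on $[0,1]$. Let $\overline{n}_{\alpha,\epsilon}=\lceil n(1-\alpha-\epsilon)\rceil$, $n_\beta=n(1-\beta-\epsilon)$ and $m=\min\{\lfloor n_\beta\rfloor+1,\ \overline{n}_{\alpha,\epsilon}-1\}$. If $n_\beta>0$, then $$\Pr\Big(\sup_{u\in[\alpha,\beta]}U_n(u)-U(u)>\epsilon\Big)=\sum_{\ell=0}^{m}\binom{n}{\ell}\Big(\min\Big\{1-\frac{\ell}{n}-\epsilon,\ \beta\Big\}\Big)^{n-\ell}(1-\beta)^\ell$$ $$\qquad+\sum_{\ell=m+1}^{\overline{n}_{\alpha,\epsilon}-1}\binom{n}{\ell}\Big(1-\frac{\ell}{n}-\epsilon\Big)^{n-\ell}\Big[\epsilon\Big(\frac{\ell}{n}+\epsilon\Big)^{\ell-1}+\sum_{j=0}^{m-1}\frac{n_\beta-j}{n}\binom{\ell}{j}\Big(\frac{\ell-n_\beta}{n}\Big)^{\ell-j-1}(1-\beta)^j\Big].$$ If $n_\beta<0$, then $$\Pr\Big(\sup_{u\in[\alpha,\beta]}U_n(u)-U(u)>\epsilon\Big)=\sum_{\ell=0}^{\overline{n}_{\alpha,\epsilon}-1}\binom{n}{\ell}\Big(1-\frac{\ell}{n}-\epsilon\Big)^{n-\ell}\epsilon\Big(\frac{\ell}{n}+\epsilon\Bi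g)^{\ell-1}.$$
   Context: The empirical CDF built from samples $X_1,\dots,X_n$ is $U_n(u)=\frac1n\sum_{i=1}^n\mathbf 1\{X_i\le u\}$. A sum $\sum_{\ell=i}^{j}$ with $i>j$ equals $0$. *)

theory Defs
  imports "HOL-Probability.Probability"
begin

definition empirical_cdf :: "nat \<Rightarrow> (nat \<Rightarrow> 'a \<Rightarrow> real) \<Rightarrow> 'a \<Rightarrow> real \<Rightarrow> real" where
  "empirical_cdf n X \<omega> u = (1 / real n) * (\<Sum>i = 1..n. of_bool (X i \<omega> \<le> u))"

definition iid_uniform01 :: "'a measure \<Rightarrow> nat \<Rightarrow> (nat \<Rightarrow> 'a \<Rightarrow> real) \<Rightarrow> bool" where
  "iid_uniform01 M n X \<longleftrightarrow>
     prob_space.indep_vars M (\<lambda>_. borel) X {1..n} \<and>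
     (\<forall>i\<in>{1..n}. distr M borel (X i) = uniform_measure lborel {0..1})"

end

theory Submission
  imports Defs
begin

text \<open>If \<open>l\<close> samples exceed \<open>u\<close>, then \<open>U\<^sub>n u - u > \<epsilon>\<close> says \<open>u < c\<^sub>l\<close> for \<open>c\<^sub>l = 1 - l / n - \<epsilon>\<close>. Hence the
  event is that for some \<open>l\<close> with \<open>c\<^sub>l > \<alpha>\<close> at most \<open>l\<close> samples lie above \<open>min c\<^sub>l \<beta>\<close>.
  Decomposing according to the first such \<open>l\<close> and the set of the exactly \<open>l\<close> samples above this level
  gives \<open>\<Sum>l. (n choose l) (1 - v\<^sub>l)\<^sup>n\<^sup>-\<^sup>l q\<^sub>l\<close>, where \<open>v\<^sub>l = 1 - min c\<^sub>l \<beta>\<close> and \<open>q\<^sub>l\<close> is the probability that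
  \<open>l\<close> points lie above level \<open>l\<close> without an earlier crossing.
  The same decomposition applied to the event that \<open>l\<close> points all lie above level \<open>l\<close>, where a
  crossing is certain, yields \<open>v\<^sub>l\<^sup>l = (\<Sum>k\<le>l. (l choose k) (v\<^sub>l - v\<^sub>k)\<^sup>l\<^sup>-\<^sup>k q\<^sub>k)\<close>. This recursion determines \<open>q\<close> without any
  integration, and Abel's binomial identity solves it.\<close>

section \<open>Abel's binomial identity\<close>

text \<open>This is \<open>x * (x + k * z) ^ (k - 1)\<close>, with the value for \<open>k = 0\<close> read as
  \<open>x * x ^ (-1) = 1\<close>.\<close>

fun abel_term :: "'a::comm_ring_1 \<Rightarrow> nat \<Rightarrow> 'a \<Rightarrow> 'a" where
  "abel_term z 0 x = 1"
| "abel_term z (Suc k) x = x * (x + of_nat (Suc k) * z) ^ k"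

lemma abel_term_mult: "(x + of_nat k * z) * abel_term z k x = x * (x + of_nat k * z) ^ k"
  by (cases k) (simp_all add: algebra_simps)

text \<open>Splits one factor \<open>x + k * z\<close> into its two parts. At \<open>k = 0\<close>
  the truncated exponent \<open>k - 1\<close> is harmless because the factor \<open>of_nat k\<close>
  vanishes.\<close>

lemma abel_term_add:
  "(x + of_nat k * z) ^ k = abel_term z k x + of_nat k * z * (x + of_nat k * z) ^ (k - 1)"
  by (cases k) (simp_all add: algebra_simps)

text \<open>Links the polynomial \<open>abel_term\<close> to the negative exponent of the final
  formula: at \<open>k = 0\<close> the right side is \<open>x * x powi (-1)\<close>, which is
  \<open>1\<close> only for nonzero \<open>x\<close>.\<close>

lemma abel_term_powi:
  fixes x :: real
  assumes "x \<noteq> 0"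
  shows "abel_term z k x = x * (x + real k * z) powi (int k - 1)"
  using assms by (cases k) (simp_all add: power_int_minus)

lemma abel_binomial_shift:
  fixes x y z :: "'a::comm_ring_1"
  shows "(\<Sum>k\<le>n. of_nat (n choose k) * abel_term z k x * (y - of_nat k * z) ^ (n - k)) = (x + y) ^ n \<and>
    (\<Sum>k\<le>n. of_nat (n choose k) * (x + z + of_nat k * z) ^ k * (y - z - of_nat k * z) ^ (n - k)) =
    (\<Sum>k\<le>n. of_nat (n choose k) * (x + of_nat k * z) ^ k * (y - of_nat k * z) ^ (n - k))"
  \<comment> \<open>The second sum depends on \<open>x\<close> and \<open>y\<close> only through \<open>x + y\<close>; the induction step of each
     claim needs the other one.\<close>
proof (induction n arbitrary: x y)
  case 0
  show ?case by simp
next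
  case (Suc n)
  define F where "F n x y = (\<Sum>k\<le>n. of_nat (n choose k) * abel_term z k x * (y - of_nat k * z) ^ (n - k))"
    for n x y
  define G where "G n x y = (\<Sum>k\<le>n. of_nat (n choose k) * (x + of_nat k * z) ^ k * (y - of_nat k * z) ^ (n - k))"
    for n x y
  have IH_F: "F n x y = (x + y) ^ n" and IH_G: "G n (x + z) (y - z) = G n x y" for x y
    using Suc.IH[of x y] by (simp_all add: F_def G_def)
  have G_shift: "G n (x + z) (y - z) =
    (\<Sum>k\<le>n. of_nat (n choose k) * (x + of_nat (Suc k) * z) ^ k * (y - of_nat (Suc k) * z) ^ (n - k))" for x y
    unfolding G_def by (intro sum.cong) (simp_all add: algebra_simps)
  have F_Suc: "F (Suc n) x y = (x + y) ^ Suc n" for x y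
  proof -
    \<comment> \<open>Pascal's rule splits \<open>Suc n choose k\<close>; the part with
      \<open>k - 1\<close> is reindexed and becomes a shifted \<open>G\<close> sum.\<close>
    have "F (Suc n) x y =
        (\<Sum>k\<le>Suc n. of_nat (n choose k) * abel_term z k x * (y - of_nat k * z) ^ (Suc n - k)) +
        (\<Sum>k\<le>n. of_nat (n choose k) * abel_term z (Suc k) x * (y - of_nat (Suc k) * z) ^ (n - k))"
      unfolding F_def
      by (subst (1 2) sum.atMost_Suc_shift) (simp add: sum.distrib algebra_simps)
    also have "(\<Sum>k\<le>n. of_nat (n choose k) * abel_term z (Suc k) x * (y - of_nat (Suc k) * z) ^ (n - k)) =
        x * G n (x + z) (y - z)"
      unfolding G_shift by (simp add: sum_distrib_left mult_ac)
    also have "(\<Sum>k\<le>Suc n. of_nat (n choose k) * abel_term z k x * (y - of_nat k * z) ^ (Suc n - k)) =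
        (\<Sum>k\<le>n. of_nat (n choose k) * abel_term z k x * (y - of_nat k * z) ^ (n - k) * (y - of_nat k * z))"
      by (simp add: binomial_eq_0 Suc_diff_le mult_ac)
    \<comment> \<open>Uses \<open>y - k * z = (x + y) - (x + k * z)\<close>, whose last bracket is
      absorbed by \<open>abel_term_mult\<close>.\<close>
    also have "\<dots> = (\<Sum>k\<le>n. (x + y) * (of_nat (n choose k) * abel_term z k x * (y - of_nat k * z) ^ (n - k))
        - x * (of_nat (n choose k) * (x + of_nat k * z) ^ k * (y - of_nat k * z) ^ (n - k)))"
    proof (intro sum.cong refl)
      fix k
      define C D where "C = (of_nat (n choose k) :: 'a)" and "D = (y - of_nat k * z) ^ (n - k)"
      have "C * abel_term z k x * D * (y - of_nat k * z) =
        (x + y) * (C * abel_term z k x * D) - C * D * ((x + of_nat k * z) * abel_term z k x)"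
        by (simp add: algebra_simps)
      then show "C * abel_term z k x * D * (y - of_nat k * z) =
        (x + y) * (C * abel_term z k x * D) - x * (C * (x + of_nat k * z) ^ k * D)"
        unfolding abel_term_mult by (simp add: mult_ac)
    qed
    also have "\<dots> = (x + y) * F n x y - x * G n x y"
      by (simp add: sum_subtractf sum_distrib_left F_def G_def)
    finally show ?thesis
      by (simp add: IH_F IH_G)
  qed
  \<comment> \<open>The correction from \<open>abel_term_add\<close> carries a factor
    \<open>k\<close>, and absorption into the binomial coefficient turns it into \<open>G n\<close>
    at shifted arguments. The right side then inherits the shift invariance of
    \<open>IH_G\<close>.\<close>
  have G_Suc: "G (Suc n) x y = (x + y) ^ Suc n + of_nat (Suc n) * z * G n x y" for x y
  proof -
    have "G (Suc n) x y = F (Suc n) x y + (\<Sum>k\<le>Suc n. of_nat (Suc n choose k) *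
        (of_nat k * z * (x + of_nat k * z) ^ (k - 1)) * (y - of_nat k * z) ^ (Suc n - k))"
      unfolding F_def G_def sum.distrib[symmetric]
      by (intro sum.cong refl, subst abel_term_add) (simp add: algebra_simps)
    also have "(\<Sum>k\<le>Suc n. of_nat (Suc n choose k) *
        (of_nat k * z * (x + of_nat k * z) ^ (k - 1)) * (y - of_nat k * z) ^ (Suc n - k)) =
      (\<Sum>k\<le>n. of_nat (Suc k * (Suc n choose Suc k)) *
        z * (x + of_nat (Suc k) * z) ^ k * (y - of_nat (Suc k) * z) ^ (n - k))"
      by (subst sum.atMost_Suc_shift)
        (simp del: binomial_Suc_Suc of_nat_Suc mult_Suc add: mult_ac)
    also have "\<dots> = of_nat (Suc n) * z * G n (x + z) (y - z)"
      unfolding G_shift Suc_times_binomial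
      by (simp del: of_nat_Suc mult_Suc add: sum_distrib_left mult_ac)
    finally show ?thesis
      unfolding F_Suc IH_G .
  qed
  have "G (Suc n) (x + z) (y - z) = G (Suc n) x y"
    by (simp add: G_Suc IH_G)
  with F_Suc[of x y] show ?case
    by (simp add: F_def G_def)
qed

theorem abel_binomial:
  fixes x y z :: "'a::comm_ring_1"
  shows "(\<Sum>k\<le>n. of_nat (n choose k) * abel_term z k x * (y - of_nat k * z) ^ (n - k)) = (x + y) ^ n"
  using abel_binomial_shift by blast

text \<open>All Abel terms share the base \<open>s = l * z - c\<close>, since
  \<open>(j * z - c) + (l - j) * z = s\<close>. So \<open>abel_term_add\<close> leaves two ordinary
  binomial expansions in \<open>b\<close> and \<open>s\<close>.\<close>

lemma abel_term_convolution:
  fixes b c z :: "'a::comm_ring_1"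
  shows "(\<Sum>j\<le>l. of_nat (l choose j) * b ^ j * abel_term z (l - j) (of_nat j * z - c)) = abel_term z l (b - c)"
proof (cases l)
  case 0
  then show ?thesis by simp
next
  case (Suc r)
  define s where "s = of_nat l * z - c"
  have summand: "abel_term z (l - j) (of_nat j * z - c) = s ^ (l - j) - of_nat (l - j) * z * s ^ (l - j - 1)"
    if "j \<le> l" for j
  proof -
    have "of_nat j * z - c + of_nat (l - j) * z = s"
      using that by (simp add: s_def of_nat_diff algebra_simps)
    then show ?thesis
      using abel_term_add[of "of_nat j * z - c" "l - j" z] by simp
  qed
  have "(\<Sum>j\<le>l. of_nat (l choose j) * b ^ j * abel_term z (l - j) (of_nat j * z - c)) =
     (\<Sum>j\<le>l. of_nat (l choose j) * b ^ j * s ^ (l - j)) -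
     (\<Sum>j\<le>l. of_nat (l choose j) * b ^ j * (of_nat (l - j) * z * s ^ (l - j - 1)))"
    unfolding sum_subtractf[symmetric] by (intro sum.cong refl) (simp add: summand right_diff_distrib)
  also have "(\<Sum>j\<le>l. of_nat (l choose j) * b ^ j * s ^ (l - j)) = (b + s) ^ l"
    by (simp add: binomial_ring)
  also have "(\<Sum>j\<le>l. of_nat (l choose j) * b ^ j * (of_nat (l - j) * z * s ^ (l - j - 1))) =
      (\<Sum>j\<le>r. of_nat ((l - j) * (l choose j)) * z * b ^ j * s ^ (r - j))"
    by (simp add: Suc mult_ac)
  also have "\<dots> = of_nat l * z * (b + s) ^ r"
    unfolding binomial_ring sum_distrib_left
  proof (intro sum.cong refl)
    fix j assume "j \<in> {..r}"
    then have "(l - j) * (l choose j) = l * (r choose j)"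
      using binomial_absorb_comp[of l j] by (simp add: Suc)
    then show "of_nat ((l - j) * (l choose j)) * z * b ^ j * s ^ (r - j) =
        of_nat l * z * (of_nat (r choose j) * b ^ j * s ^ (r - j))"
      by (simp add: mult_ac)
  qed
  also have "(b + s) ^ l - of_nat l * z * (b + s) ^ r = (b - c) * (b + s) ^ r"
    by (simp add: Suc s_def algebra_simps)
  also have "b + s = b - c + of_nat l * z"
    by (simp add: s_def)
  finally show ?thesis
    by (simp add: Suc)
qed

text \<open>The probability that \<open>l\<close> uniform points form a strict ladder (see below) for upper sets of
  measure \<open>b\<close> (levels below \<open>m\<close>) and \<open>b + l * z - c\<close> (levels from \<open>m\<close> on). The \<open>j\<close>-th summand in
  \<open>crossing_weight_ge\<close> is the contribution of the configurations with \<open>j\<close> points in the set of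
  measure \<open>b\<close>.\<close>

definition crossing_weight :: "'a::comm_ring_1 \<Rightarrow> 'a \<Rightarrow> 'a \<Rightarrow> nat \<Rightarrow> nat \<Rightarrow> 'a" where
  "crossing_weight z b c m l = (if l < m then b ^ l else
     abel_term z l (b - c) - (\<Sum>j<m. of_nat (l choose j) * b ^ j * abel_term z (l - j) (of_nat j * z - c)))"

text \<open>The full convolution is \<open>abel_term z l (b - c)\<close>, so removing its terms
  below \<open>m\<close> leaves the others. This form suits the double sum of the recursion and
  yields \<open>b ^ m\<close> at once for \<open>l = m\<close>.\<close>

lemma crossing_weight_ge:
  assumes "m \<le> l"
  shows "crossing_weight z b c m l =
    (\<Sum>j=m..l. of_nat (l choose j) * b ^ j * abel_term z (l - j) (of_nat j * z - c))"
proof -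
  have "{..l} = {..<m} \<union> {m..l}" "{..<m} \<inter> {m..l} = {}"
    using assms by auto
  then show ?thesis
    using assms abel_term_convolution[of l b z c]
    by (simp add: crossing_weight_def sum.union_disjoint algebra_simps)
qed

text \<open>For \<open>l \<ge> m\<close>, exchanging the sums leaves an instance of Abel's identity
  in \<open>k\<close> for each \<open>j\<close>. This produces the terms \<open>j \<ge> m\<close> of
  the binomial expansion of \<open>(b + s) ^ l\<close>, and the levels below \<open>m\<close> supply
  the others.\<close>

lemma crossing_weight_recursion:
  fixes b c z :: "'a::comm_ring_1" and m :: nat
  defines "v \<equiv> \<lambda>l. if l < m then b else b + of_nat l * z - c"
  shows "v l ^ l = (\<Sum>k\<le>l. of_nat (l choose k) * (v l - v k) ^ (l - k) * crossing_weight z b c m k)"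
proof (cases "l < m")
  case True
  \<comment> \<open>Below \<open>m\<close> the values \<open>v\<close> are constant, so only
    \<open>k = l\<close> survives, through \<open>0 ^ 0 = 1\<close>.\<close>
  then have "(\<Sum>k\<le>l. of_nat (l choose k) * (v l - v k) ^ (l - k) * crossing_weight z b c m k) =
      (\<Sum>k\<le>l. if k = l then b ^ l else 0)"
    by (intro sum.cong) (auto simp: v_def crossing_weight_def power_0_left)
  then show ?thesis
    using True by (simp add: v_def)
next
  case False
  define s where "s = of_nat l * z - c"
  have split: "{..l} = {..<m} \<union> {m..l}" "{..<m} \<inter> {m..l} = {}"
    using False by auto
  have "(\<Sum>k=m..l. of_nat (l choose k) * (v l - v k) ^ (l - k) * crossing_weight z b c m k) =
      (\<Sum>k=m..l. \<Sum>j=m..k. of_nat (l choose k) * (v l - v k) ^ (l - k) *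
        (of_nat (k choose j) * b ^ j * abel_term z (k - j) (of_nat j * z - c)))"
    by (intro sum.cong refl) (simp add: crossing_weight_ge sum_distrib_left)
  also have "\<dots> = (\<Sum>j=m..l. \<Sum>k=j..l. of_nat (l choose k) * (v l - v k) ^ (l - k) *
        (of_nat (k choose j) * b ^ j * abel_term z (k - j) (of_nat j * z - c)))"
    unfolding sum.Sigma[OF finite_atLeastAtMost ballI[OF finite_atLeastAtMost]]
    by (intro sum.reindex_bij_witness[of _ prod.swap prod.swap]) auto
  also have "\<dots> = (\<Sum>j=m..l. of_nat (l choose j) * b ^ j * s ^ (l - j))"
  proof (intro sum.cong refl)
    fix j assume "j \<in> {m..l}"
    then have j: "m \<le> j" "j \<le> l" by auto
    have "(\<Sum>k=j..l. of_nat (l choose k) * (v l - v k) ^ (l - k) *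
        (of_nat (k choose j) * b ^ j * abel_term z (k - j) (of_nat j * z - c))) =
      (\<Sum>k\<le>l - j. of_nat (l choose (k + j)) * (v l - v (k + j)) ^ (l - (k + j)) *
        (of_nat ((k + j) choose j) * b ^ j * abel_term z k (of_nat j * z - c)))"
      using j by (intro sum.reindex_bij_witness[of _ "\<lambda>k. k + j" "\<lambda>k. k - j"]) auto
    also have "\<dots> = of_nat (l choose j) * b ^ j *
      (\<Sum>k\<le>l - j. of_nat ((l - j) choose k) * abel_term z k (of_nat j * z - c) * (of_nat (l - j) * z - of_nat k * z) ^ (l - j - k))"
      unfolding sum_distrib_left
    proof (intro sum.cong refl)
      fix k assume "k \<in> {..l - j}"
      then have k: "k + j \<le> l" using j by auto
      have "(l choose (k + j)) * ((k + j) choose j) = (l choose j) * ((l - j) choose k)"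
        using choose_mult[of j "k + j" l] k by simp
      then have C: "of_nat (l choose (k + j)) * of_nat ((k + j) choose j) = (of_nat (l choose j) * of_nat ((l - j) choose k) :: 'a)"
        by (metis of_nat_mult)
      have D: "v l - v (k + j) = of_nat (l - j) * z - of_nat k * z"
        using j False by (simp add: v_def of_nat_diff algebra_simps)
      have E: "l - (k + j) = l - j - k" by simp
      define A P where "A = abel_term z k (of_nat j * z - c)"
        and "P = (of_nat (l - j) * z - of_nat k * z) ^ (l - j - k)"
      show "of_nat (l choose (k + j)) * (v l - v (k + j)) ^ (l - (k + j)) *
        (of_nat ((k + j) choose j) * b ^ j * abel_term z k (of_nat j * z - c)) =
        of_nat (l choose j) * b ^ j * (of_nat ((l - j) choose k) * abel_term z k (of_nat j * z - c)
          * (of_nat (l - j) * z - of_nat k * z) ^ (l - j - k))"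
        unfolding D E A_def[symmetric] P_def[symmetric]
        using arg_cong[OF C, of "\<lambda>t. t * (b ^ j * A * P)"] by (simp add: mult_ac)
    qed
    also have "\<dots> = of_nat (l choose j) * b ^ j * s ^ (l - j)"
      unfolding abel_binomial using j by (simp add: s_def of_nat_diff algebra_simps)
    finally show "(\<Sum>k=j..l. of_nat (l choose k) * (v l - v k) ^ (l - k) *
        (of_nat (k choose j) * b ^ j * abel_term z (k - j) (of_nat j * z - c))) =
      of_nat (l choose j) * b ^ j * s ^ (l - j)" .
  qed
  finally have upper: "(\<Sum>k=m..l. of_nat (l choose k) * (v l - v k) ^ (l - k) * crossing_weight z b c m k) =
    (\<Sum>j=m..l. of_nat (l choose j) * b ^ j * s ^ (l - j))" .
  have lower: "(\<Sum>k<m. of_nat (l choose k) * (v l - v k) ^ (l - k) * crossing_weight z b c m k) =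
    (\<Sum>j<m. of_nat (l choose j) * b ^ j * s ^ (l - j))"
    using False by (intro sum.cong refl) (simp add: v_def s_def crossing_weight_def algebra_simps)
  have "v l ^ l = (\<Sum>j\<le>l. of_nat (l choose j) * b ^ j * s ^ (l - j))"
    unfolding binomial_ring[symmetric] using False by (simp add: v_def s_def algebra_simps)
  then show ?thesis
    using split by (simp add: sum.union_disjoint upper lower)
qed

section \<open>First crossing of a chain of sets\<close>

text \<open>With \<open>V j\<close> as the set of points above level \<open>j\<close>, and level \<open>j\<close> crossed when at most \<open>j\<close> points
  lie above it, level \<open>card B\<close> is the first one that the points indexed by \<open>B\<close> cross.\<close>

definition strict_ladder :: "(nat \<Rightarrow> 'b set) \<Rightarrow> 'i set \<Rightarrow> ('i \<Rightarrow> 'b) \<Rightarrow> bool" where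
  "strict_ladder V B f \<longleftrightarrow> (\<forall>i\<in>B. f i \<in> V (card B)) \<and> (\<forall>j<card B. j < card {i\<in>B. f i \<in> V j})"

lemma strict_ladder_cong:
  "(\<And>i. i \<in> B \<Longrightarrow> f i = g i) \<Longrightarrow> strict_ladder V B f \<longleftrightarrow> strict_ladder V B g"
  unfolding strict_ladder_def by (simp cong: conj_cong)

text \<open>From left to right, \<open>B\<close> collects the points above the least crossed level;
  from right to left, \<open>B\<close> is exactly the set of points above level
  \<open>card B\<close>, which is therefore crossed.\<close>

lemma first_crossing_iff:
  assumes V: "mono V" and A: "finite A"
  shows "(\<exists>l\<le>L. card {i\<in>A. f i \<in> V l} \<le> l) \<longleftrightarrow>
    (\<exists>B\<subseteq>A. card B \<le> L \<and> strict_ladder V B f \<and> (\<forall>i\<in>A - B. f i \<notin> V (card B)))"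
    (is "?lhs \<longleftrightarrow> ?rhs")
proof
  assume ?lhs
  then obtain l0 where l0: "l0 \<le> L" "card {i\<in>A. f i \<in> V l0} \<le> l0" by blast
  define l where "l = (LEAST l. card {i\<in>A. f i \<in> V l} \<le> l)"
  have l: "card {i\<in>A. f i \<in> V l} \<le> l"
    unfolding l_def by (rule LeastI[of "\<lambda>l. card {i\<in>A. f i \<in> V l} \<le> l", OF l0(2)])
  have below: "j < card {i\<in>A. f i \<in> V j}" if "j < l" for j
    using not_less_Least[of j "\<lambda>l. card {i\<in>A. f i \<in> V l} \<le> l"] that by (simp add: l_def not_le)
  have "l \<le> L"
    using Least_le[of "\<lambda>l. card {i\<in>A. f i \<in> V l} \<le> l", OF l0(2)] l0(1) by (simp add: l_def)
  define B where "B = {i\<in>A. f i \<in> V l}"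
  have card_mono': "card {i\<in>A. f i \<in> V j} \<le> card B" if "j \<le> l" for j
    unfolding B_def using A monoD[OF V that] by (intro card_mono) auto
  \<comment> \<open>Level \<open>l - 1\<close> is not crossed, so at least \<open>l\<close> points
    lie above it, and by monotonicity of \<open>V\<close> above level \<open>l\<close> too.\<close>
  have "card B = l"
  proof (cases l)
    case 0
    with l show ?thesis by (simp add: B_def)
  next
    case (Suc j)
    with below[of j] card_mono'[of j] l show ?thesis by (simp add: B_def)
  qed
  moreover have "{i\<in>B. f i \<in> V j} = {i\<in>A. f i \<in> V j}" if "j < l" for j
    using monoD[OF V less_imp_le[OF that]] by (auto simp: B_def)
  ultimately have "strict_ladder V B f"
    using below by (auto simp: strict_ladder_def B_def)
  then show ?rhs
    using \<open>card B = l\<close> \<open>l \<le> L\<close> by (intro exI[of _ B]) (auto simp: B_def)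
next
  assume ?rhs
  then obtain B where B: "B \<subseteq> A" "card B \<le> L" "strict_ladder V B f" "\<forall>i\<in>A - B. f i \<notin> V (card B)"
    by blast
  then have "{i\<in>A. f i \<in> V (card B)} = B"
    by (auto simp: strict_ladder_def)
  with B(2) show ?lhs by (metis order_refl)
qed

text \<open>Each such set consists of the points above the level given by its size, so equal sizes
  suffice. A larger set would need more points above the smaller level than the smaller set
  provides. This makes the events of the decomposition disjoint.\<close>

lemma first_crossing_unique:
  assumes V: "mono V" and A: "finite A" and "B \<subseteq> A" "B' \<subseteq> A"
    and "strict_ladder V B f" "\<forall>i\<in>A - B. f i \<notin> V (card B)"
    and "strict_ladder V B' f" "\<forall>i\<in>A - B'. f i \<notin> V (card B')"
  shows "B = B'"
proof -
  have eq: "{i\<in>A. f i \<in> V (card C)} = C"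
    if "C \<subseteq> A" "strict_ladder V C f" "\<forall>i\<in>A - C. f i \<notin> V (card C)" for C
    using that by (auto simp: strict_ladder_def)
  have le: "card D \<le> card C"
    if "C \<subseteq> A" "D \<subseteq> A" "strict_ladder V C f" "\<forall>i\<in>A - C. f i \<notin> V (card C)" "strict_ladder V D f"
    for C D
  proof (rule ccontr)
    assume "\<not> card D \<le> card C"
    then have "card C < card {i\<in>D. f i \<in> V (card C)}"
      using that(5) by (auto simp: strict_ladder_def)
    also have "\<dots> \<le> card {i\<in>A. f i \<in> V (card C)}"
      using that(2) A by (intro card_mono) auto
    finally show False
      using eq[OF that(1,3,4)] by simp
  qed
  have "card B = card B'"
    using assms le by (intro antisym) blast+
  then show ?thesis
    using eq[of B] eq[of B'] assms by metis
qed

text \<open>Cardinalities are rewritten as sums of indicators, whose measurability is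
  automatic.\<close>

lemma measurable_strict_ladder:
  assumes [measurable]: "\<And>k. V k \<in> sets N" and B: "finite B"
  shows "Measurable.pred (PiM B (\<lambda>_. N)) (strict_ladder V B)"
proof -
  have card_eq: "real (card {i\<in>B. f i \<in> V j}) = (\<Sum>i\<in>B. indicator (V j) (f i))" for f j
    using B by (simp add: indicator_def sum.If_cases Int_def)
  have "strict_ladder V B f \<longleftrightarrow>
      (\<forall>i\<in>B. f i \<in> V (card B)) \<and> (\<forall>j\<in>{..<card B}. real j < (\<Sum>i\<in>B. indicator (V j) (f i)))" for f
    unfolding card_eq[symmetric] strict_ladder_def by auto
  moreover have "Measurable.pred (PiM B (\<lambda>_. N)) (\<lambda>f.
      (\<forall>i\<in>B. f i \<in> V (card B)) \<and> (\<forall>j\<in>{..<card B}. real j < (\<Sum>i\<in>B. indicator (V j) (f i))))"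
    using B by measurable
  ultimately show ?thesis
    by (simp cong: measurable_cong)
qed

lemma sum_subsets_card:
  fixes g :: "nat \<Rightarrow> 'a::comm_semiring_1"
  assumes "finite A"
  shows "(\<Sum>B | B \<subseteq> A \<and> card B \<le> L. g (card B)) = (\<Sum>l\<le>L. of_nat (card A choose l) * g l)"
proof -
  have fin: "finite {B. B \<subseteq> A \<and> card B \<le> L}"
    using assms by simp
  have "(\<Sum>B | B \<subseteq> A \<and> card B \<le> L. g (card B)) =
      (\<Sum>l\<le>L. \<Sum>B | B \<in> {B. B \<subseteq> A \<and> card B \<le> L} \<and> card B = l. g (card B))"
    by (rule sum.group[symmetric]) (use fin in auto)
  also have "\<dots> = (\<Sum>l\<le>L. of_nat (card A choose l) * g l)"
  proof (intro sum.cong refl)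
    fix l assume "l \<in> {..L}"
    then have "{B. B \<in> {B. B \<subseteq> A \<and> card B \<le> L} \<and> card B = l} = {B. B \<subseteq> A \<and> card B = l}"
      by auto
    then show "(\<Sum>B | B \<in> {B. B \<subseteq> A \<and> card B \<le> L} \<and> card B = l. g (card B)) = of_nat (card A choose l) * g l"
      by (simp add: n_subsets[OF assms, symmetric])
  qed
  finally show ?thesis .
qed

section \<open>Probabilities of first crossings for independent variables\<close>

context prob_space
begin

lemma prob_all_in:
  assumes "indep_vars (\<lambda>_. N) X I" "finite C" "C \<subseteq> I" "S \<in> sets N"
    and "\<And>i. i \<in> C \<Longrightarrow> \<P>(\<omega> in M. X i \<omega> \<in> S) = s"
  shows "\<P>(\<omega> in M. \<forall>i\<in>C. X i \<omega> \<in> S) = s ^ card C"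
\<comment> \<open>An intersection over an empty \<open>C\<close> would be the whole type instead of
  \<open>space M\<close>.\<close>
proof (cases "C = {}")
  case True
  then show ?thesis by (simp add: prob_space)
next
  case False
  have "{\<omega>\<in>space M. \<forall>i\<in>C. X i \<omega> \<in> S} = (\<Inter>i\<in>C. X i -` S \<inter> space M)"
    using False by auto
  also have "prob \<dots> = (\<Prod>i\<in>C. prob (X i -` S \<inter> space M))"
    using assms False by (intro indep_varsD[where I = I]) auto
  also have "\<dots> = (\<Prod>i\<in>C. s)"
    using assms(5) by (intro prod.cong refl) (simp add: vimage_def Int_def conj_commute)
  finally show ?thesis by simp
qed

text \<open>The ladder event depends only on the variables in \<open>B\<close>, the other event only
  on those in \<open>A - B\<close>; disjoint blocks of an independent family are
  independent.\<close>

lemma prob_first_crossing_at: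
  assumes indep: "indep_vars (\<lambda>_. N) X I" and fin: "finite I" "B \<subseteq> A" "A \<subseteq> I"
    and V: "\<And>k. V k \<in> sets N" and S: "S \<in> sets N"
    and s: "\<And>i. i \<in> I \<Longrightarrow> \<P>(\<omega> in M. X i \<omega> \<in> S) = s"
  shows "\<P>(\<omega> in M. strict_ladder V B (\<lambda>i. X i \<omega>) \<and> (\<forall>i\<in>A - B. X i \<omega> \<in> S)) =
    \<P>(\<omega> in M. strict_ladder V B (\<lambda>i. X i \<omega>)) * s ^ (card A - card B)"
    and "{\<omega>\<in>space M. strict_ladder V B (\<lambda>i. X i \<omega>) \<and> (\<forall>i\<in>A - B. X i \<omega> \<in> S)} \<in> events"
proof -
  have finite: "finite A" "finite B" "finite (A - B)"
    using fin finite_subset[of A I] finite_subset[of B A] by auto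
  have X: "X i \<in> measurable M N" if "i \<in> I" for i
    using indep that by (simp add: indep_vars_def)
  let ?P = "PiM B (\<lambda>_. N)" and ?Q = "PiM (A - B) (\<lambda>_. N)"
  let ?F = "\<lambda>\<omega>. restrict (\<lambda>i. X i \<omega>) B" and ?G = "\<lambda>\<omega>. restrict (\<lambda>i. X i \<omega>) (A - B)"
  define E where "E = {f\<in>space ?P. strict_ladder V B f}"
  define D where "D = {f\<in>space ?Q. \<forall>i\<in>A - B. f i \<in> S}"
  have E: "E \<in> sets ?P"
    unfolding E_def using measurable_strict_ladder[OF V finite(2)] by (simp add: pred_def)
  have D: "D \<in> sets ?Q"
    unfolding D_def using S finite(3) by measurable
  have F: "?F \<in> measurable M ?P" and G: "?G \<in> measurable M ?Q"
    using X fin by (auto intro!: measurable_restrict)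
  have ladder: "strict_ladder V B (?F \<omega>) \<longleftrightarrow> strict_ladder V B (\<lambda>i. X i \<omega>)" for \<omega>
    by (rule strict_ladder_cong) simp
  have FE: "?F -` E \<inter> space M = {\<omega>\<in>space M. strict_ladder V B (\<lambda>i. X i \<omega>)}"
    using measurable_space[OF F] by (auto simp: E_def ladder)
  have GD: "?G -` D \<inter> space M = {\<omega>\<in>space M. \<forall>i\<in>A - B. X i \<omega> \<in> S}"
    using measurable_space[OF G] by (auto simp: D_def)
  have both: "{\<omega>\<in>space M. strict_ladder V B (\<lambda>i. X i \<omega>) \<and> (\<forall>i\<in>A - B. X i \<omega> \<in> S)} =
      (\<lambda>\<omega>. (?F \<omega>, ?G \<omega>)) -` (E \<times> D) \<inter> space M"
    using FE GD by blast
  have "indep_var ?P ?F ?Q ?G"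
    using fin by (intro indep_var_restrict[OF indep]) auto
  from indep_varD[OF this E D]
  have "\<P>(\<omega> in M. strict_ladder V B (\<lambda>i. X i \<omega>) \<and> (\<forall>i\<in>A - B. X i \<omega> \<in> S)) =
    \<P>(\<omega> in M. strict_ladder V B (\<lambda>i. X i \<omega>)) * \<P>(\<omega> in M. \<forall>i\<in>A - B. X i \<omega> \<in> S)"
    unfolding both FE GD .
  also have "\<P>(\<omega> in M. \<forall>i\<in>A - B. X i \<omega> \<in> S) = s ^ card (A - B)"
    using fin finite s by (intro prob_all_in[OF indep _ _ S]) auto
  also have "card (A - B) = card A - card B"
    using fin finite by (simp add: card_Diff_subset)
  finally show "\<P>(\<omega> in M. strict_ladder V B (\<lambda>i. X i \<omega>) \<and> (\<forall>i\<in>A - B. X i \<omega> \<in> S)) =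
    \<P>(\<omega> in M. strict_ladder V B (\<lambda>i. X i \<omega>)) * s ^ (card A - card B)" .
  have "(\<lambda>\<omega>. (?F \<omega>, ?G \<omega>)) -` (E \<times> D) \<inter> space M = (?F -` E \<inter> space M) \<inter> (?G -` D \<inter> space M)"
    by auto
  then show "{\<omega>\<in>space M. strict_ladder V B (\<lambda>i. X i \<omega>) \<and> (\<forall>i\<in>A - B. X i \<omega> \<in> S)} \<in> events"
    unfolding both using measurable_sets[OF F E] measurable_sets[OF G D] by auto
qed

text \<open>The confining set \<open>W\<close> allows two uses: \<open>W = V l\<close> gives the
  recursion for the ladder probabilities, and \<open>W = space N\<close> gives the crossing
  probability itself.\<close>

lemma prob_crossing_decomposition:
  assumes indep: "indep_vars (\<lambda>_. N) X I" and fin: "finite I" "A \<subseteq> I"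
    and V: "mono V" "\<And>k. V k \<in> sets N" and W: "W \<in> sets N" "\<And>k. k \<le> L \<Longrightarrow> V k \<subseteq> W"
    and v: "\<And>i k. i \<in> I \<Longrightarrow> k \<le> L \<Longrightarrow> \<P>(\<omega> in M. X i \<omega> \<in> V k) = v k"
    and w: "\<And>i. i \<in> I \<Longrightarrow> \<P>(\<omega> in M. X i \<omega> \<in> W) = w"
  shows "\<P>(\<omega> in M. (\<forall>i\<in>A. X i \<omega> \<in> W) \<and> (\<exists>l\<le>L. card {i\<in>A. X i \<omega> \<in> V l} \<le> l)) =
    (\<Sum>B | B \<subseteq> A \<and> card B \<le> L.
      \<P>(\<omega> in M. strict_ladder V B (\<lambda>i. X i \<omega>)) * (w - v (card B)) ^ (card A - card B))"
proof -
  have finA: "finite A"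
    using fin finite_subset[of A I] by auto
  define \<B> where "\<B> = {B. B \<subseteq> A \<and> card B \<le> L}"
  have X: "X i \<in> measurable M N" if "i \<in> I" for i
    using indep that by (simp add: indep_vars_def)
  define E where "E B = {\<omega>\<in>space M. strict_ladder V B (\<lambda>i. X i \<omega>) \<and> (\<forall>i\<in>A - B. X i \<omega> \<in> W - V (card B))}" for B
  have diff: "\<P>(\<omega> in M. X i \<omega> \<in> W - V k) = w - v k" if "i \<in> I" "k \<le> L" for i k
  proof -
    have "{\<omega>\<in>space M. X i \<omega> \<in> W - V k} = {\<omega>\<in>space M. X i \<omega> \<in> W} - {\<omega>\<in>space M. X i \<omega> \<in> V k}"
      by auto
    moreover have "{\<omega>\<in>space M. X i \<omega> \<in> W} \<in> events" "{\<omega>\<in>space M. X i \<omega> \<in> V k} \<in> events"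
      using measurable_sets[OF X[OF that(1)] W(1)] measurable_sets[OF X[OF that(1)] V(2)[of k]]
      by (simp_all add: vimage_def Int_def conj_commute)
    ultimately show ?thesis
      using that W(2)[of k] v w by (simp add: finite_measure_Diff subset_iff)
  qed
  have "{\<omega>\<in>space M. (\<forall>i\<in>A. X i \<omega> \<in> W) \<and> (\<exists>l\<le>L. card {i\<in>A. X i \<omega> \<in> V l} \<le> l)} = (\<Union>B\<in>\<B>. E B)"
  proof -
    \<comment> \<open>Points of \<open>B\<close> lie in \<open>V (card B)\<close> and hence in
      \<open>W\<close>, so confinement restricts only the points outside \<open>B\<close>.\<close>
    have "x i \<in> W"
      if "card B \<le> L" "strict_ladder V B x" "\<forall>i\<in>A - B. x i \<in> W - V (card B)" "i \<in> A" for x B i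
      using that W(2)[of "card B"] by (cases "i \<in> B") (auto simp: strict_ladder_def)
    then have "(\<forall>i\<in>A. x i \<in> W) \<and> (\<exists>l\<le>L. card {i\<in>A. x i \<in> V l} \<le> l) \<longleftrightarrow>
        (\<exists>B\<in>\<B>. strict_ladder V B x \<and> (\<forall>i\<in>A - B. x i \<in> W - V (card B)))" for x
      unfolding first_crossing_iff[OF V(1) finA, of L] \<B>_def by blast
    note crossing_iff = this[of "\<lambda>i. X i \<omega>" for \<omega>]
    show ?thesis
      unfolding E_def crossing_iff by blast
  qed
  moreover have "prob (\<Union>B\<in>\<B>. E B) = (\<Sum>B\<in>\<B>. prob (E B))"
  proof (rule finite_measure_finite_Union)
    show "finite \<B>" using finA by (simp add: \<B>_def)
    show "E ` \<B> \<subseteq> events"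
    proof (intro image_subsetI)
      fix B assume "B \<in> \<B>"
      then show "E B \<in> events"
        unfolding E_def using V(2) W(1)
        by (intro prob_first_crossing_at(2)[where s = "w - v (card B)", OF indep fin(1) _ fin(2) V(2)] diff) (auto simp: \<B>_def)
    qed
    show "disjoint_family_on E \<B>"
      unfolding disjoint_family_on_def
    proof (intro ballI impI)
      fix B C assume BC: "B \<in> \<B>" "C \<in> \<B>" "B \<noteq> C"
      show "E B \<inter> E C = {}"
      proof (rule ccontr)
        assume "E B \<inter> E C \<noteq> {}"
        then obtain \<omega> where "\<omega> \<in> E B" "\<omega> \<in> E C" by blast
        then have "B = C"
          using BC by (intro first_crossing_unique[OF V(1) finA, of B C "\<lambda>i. X i \<omega>"]) (auto simp: E_def \<B>_def)
        with BC show False by simp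
      qed
    qed
  qed
  moreover have "prob (E B) = \<P>(\<omega> in M. strict_ladder V B (\<lambda>i. X i \<omega>)) * (w - v (card B)) ^ (card A - card B)"
    if "B \<in> \<B>" for B
    unfolding E_def using that V(2) W(1)
    by (intro prob_first_crossing_at(1)[OF indep fin(1) _ fin(2) V(2)] diff) (auto simp: \<B>_def)
  ultimately show ?thesis
    by (simp add: \<B>_def)
qed

text \<open>Both the ladder probabilities and \<open>q\<close> satisfy the same triangular
  recursion, in which the term of \<open>A\<close> itself has coefficient
  \<open>(v l - v l) ^ 0 = 1\<close>. Induction on the size settles all proper subsets.\<close>

lemma prob_strict_ladder:
  assumes indep: "indep_vars (\<lambda>_. N) X I" and fin: "finite I"
    and V: "mono V" "\<And>k. V k \<in> sets N"
    and v: "\<And>i k. i \<in> I \<Longrightarrow> k \<le> L \<Longrightarrow> \<P>(\<omega> in M. X i \<omega> \<in> V k) = v k"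
    and q: "\<And>l. l \<le> L \<Longrightarrow> v l ^ l = (\<Sum>k\<le>l. of_nat (l choose k) * (v l - v k) ^ (l - k) * q k)"
    and A: "A \<subseteq> I" "card A \<le> L"
  shows "\<P>(\<omega> in M. strict_ladder V A (\<lambda>i. X i \<omega>)) = q (card A)"
  using A
proof (induction "card A" arbitrary: A rule: less_induct)
  case less
  define l where "l = card A"
  have finA: "finite A"
    using fin less.prems finite_subset[of A I] by auto
  let ?g = "\<lambda>B. \<P>(\<omega> in M. strict_ladder V B (\<lambda>i. X i \<omega>))"
  have sub: "{B. B \<subseteq> A \<and> card B \<le> l} = insert A {B. B \<subset> A}"
    using finA by (auto simp: l_def intro: card_mono)
  have finB: "finite {B. B \<subset> A}"
    using finA by (auto intro: finite_subset[of _ "Pow A"])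
  \<comment> \<open>With only \<open>l\<close> points in \<open>A\<close>, level \<open>l\<close> is
    always crossed.\<close>
  have "\<exists>k\<le>l. card {i\<in>A. X i \<omega> \<in> V k} \<le> k" for \<omega>
    using finA by (intro exI[of _ l]) (auto simp: l_def intro!: card_mono)
  then have ev: "{\<omega>\<in>space M. (\<forall>i\<in>A. X i \<omega> \<in> V l) \<and> (\<exists>k\<le>l. card {i\<in>A. X i \<omega> \<in> V k} \<le> k)} =
      {\<omega>\<in>space M. \<forall>i\<in>A. X i \<omega> \<in> V l}"
    by simp
  have "v l ^ l = \<P>(\<omega> in M. \<forall>i\<in>A. X i \<omega> \<in> V l)"
    using less.prems v by (subst prob_all_in[OF indep finA less.prems(1) V(2)]) (auto simp: l_def)
  also have "\<dots> = (\<Sum>B | B \<subseteq> A \<and> card B \<le> l. ?g B * (v l - v (card B)) ^ (l - card B))"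
    using less.prems v monoD[OF V(1)]
    by (subst ev[symmetric], subst prob_crossing_decomposition[OF indep fin less.prems(1) V V(2), where w = "v l" and v = v])
      (auto simp: l_def)
  also have "\<dots> = ?g A + (\<Sum>B | B \<subset> A. ?g B * (v l - v (card B)) ^ (l - card B))"
    unfolding sub using finB by (simp add: l_def)
  also have "(\<Sum>B | B \<subset> A. ?g B * (v l - v (card B)) ^ (l - card B)) =
      (\<Sum>B | B \<subset> A. q (card B) * (v l - v (card B)) ^ (l - card B))"
  proof (intro sum.cong refl)
    fix B assume "B \<in> {B. B \<subset> A}"
    then have "?g B = q (card B)"
      using less.prems finA psubset_card_mono[of A B] by (intro less.hyps) auto
    then show "?g B * (v l - v (card B)) ^ (l - card B) = q (card B) * (v l - v (card B)) ^ (l - card B)"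
      by simp
  qed
  finally have lhs: "v l ^ l = ?g A + (\<Sum>B | B \<subset> A. q (card B) * (v l - v (card B)) ^ (l - card B))" .
  have "v l ^ l = (\<Sum>k\<le>l. of_nat (card A choose k) * (q k * (v l - v k) ^ (l - k)))"
    using q[of l] less.prems by (simp add: l_def mult_ac)
  also have "\<dots> = (\<Sum>B | B \<subseteq> A \<and> card B \<le> l. q (card B) * (v l - v (card B)) ^ (l - card B))"
    using sum_subsets_card[OF finA, of "\<lambda>k. q k * (v l - v k) ^ (l - k)" l] by simp
  also have "\<dots> = q l + (\<Sum>B | B \<subset> A. q (card B) * (v l - v (card B)) ^ (l - card B))"
    unfolding sub using finB by (simp add: l_def)
  finally show ?case
    using lhs by (simp add: l_def)
qed

theorem prob_crossing:
  assumes indep: "indep_vars (\<lambda>_. N) X I" and fin: "finite I"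
    and V: "mono V" "\<And>k. V k \<in> sets N"
    and v: "\<And>i k. i \<in> I \<Longrightarrow> k \<le> L \<Longrightarrow> \<P>(\<omega> in M. X i \<omega> \<in> V k) = v k"
    and q: "\<And>l. l \<le> L \<Longrightarrow> v l ^ l = (\<Sum>k\<le>l. of_nat (l choose k) * (v l - v k) ^ (l - k) * q k)"
  shows "\<P>(\<omega> in M. \<exists>l\<le>L. card {i\<in>I. X i \<omega> \<in> V l} \<le> l) =
    (\<Sum>l\<le>L. of_nat (card I choose l) * (1 - v l) ^ (card I - l) * q l)"
proof -
  have X: "X i \<omega> \<in> space N" if "i \<in> I" "\<omega> \<in> space M" for i \<omega>
    using indep that by (auto simp: indep_vars_def dest: measurable_space)
  then have "{\<omega>\<in>space M. X i \<omega> \<in> space N} = space M" if "i \<in> I" for i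
    using that by auto
  then have w: "\<P>(\<omega> in M. X i \<omega> \<in> space N) = 1" if "i \<in> I" for i
    using that by (simp add: prob_space)
  have "{\<omega>\<in>space M. \<exists>l\<le>L. card {i\<in>I. X i \<omega> \<in> V l} \<le> l} =
      {\<omega>\<in>space M. (\<forall>i\<in>I. X i \<omega> \<in> space N) \<and> (\<exists>l\<le>L. card {i\<in>I. X i \<omega> \<in> V l} \<le> l)}"
    using X by auto
  also have "prob \<dots> = (\<Sum>B | B \<subseteq> I \<and> card B \<le> L.
      \<P>(\<omega> in M. strict_ladder V B (\<lambda>i. X i \<omega>)) * (1 - v (card B)) ^ (card I - card B))"
    using v w V(2) by (intro prob_crossing_decomposition[OF indep fin]) (auto simp: V sets.sets_into_space)
  also have "\<dots> = (\<Sum>B | B \<subseteq> I \<and> card B \<le> L. q (card B) * (1 - v (card B)) ^ (card I - card B))"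
    by (intro sum.cong refl) (simp add: prob_strict_ladder[OF indep fin V v q])
  also have "\<dots> = (\<Sum>l\<le>L. of_nat (card I choose l) * (q l * (1 - v l) ^ (card I - l)))"
    using sum_subsets_card[OF fin, of "\<lambda>l. q l * (1 - v l) ^ (card I - l)" L] by simp
  finally show ?thesis
    by (simp add: mult_ac)
qed

end

section \<open>The empirical distribution function\<close>

text \<open>For a level \<open>c \<le> \<beta>\<close> the points \<open>u < c\<close> can be taken arbitrarily close to \<open>c\<close>, so a sample
  equal to \<open>c\<close> counts as exceeding; for \<open>c > \<beta>\<close> the best choice \<open>u = \<beta>\<close> is attained.\<close>

definition exceedance_set :: "real \<Rightarrow> real \<Rightarrow> real set" where
  "exceedance_set \<beta> c = (if \<beta> < c then {\<beta><..} else {c..})"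

lemma antimono_exceedance_set: "antimono (exceedance_set \<beta>)"
  by (rule antimonoI) (auto simp: exceedance_set_def)

lemma sets_exceedance_set: "exceedance_set \<beta> c \<in> sets borel"
  by (simp add: exceedance_set_def)

lemma empirical_cdf_eq:
  assumes "n \<ge> 1"
  shows "empirical_cdf n X \<omega> u = 1 - real (card {i\<in>{1..n}. u < X i \<omega>}) / real n"
proof -
  have "{1..n} = {i\<in>{1..n}. X i \<omega> \<le> u} \<union> {i\<in>{1..n}. u < X i \<omega>}" by auto
  then have "n = card ({i\<in>{1..n}. X i \<omega> \<le> u} \<union> {i\<in>{1..n}. u < X i \<omega>})"
    by (metis card_atLeastAtMost diff_Suc_1)
  also have "\<dots> = card {i\<in>{1..n}. X i \<omega> \<le> u} + card {i\<in>{1..n}. u < X i \<omega>}"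
    by (intro card_Un_disjoint) auto
  finally have "real (card {i\<in>{1..n}. X i \<omega> \<le> u}) = real n - real (card {i\<in>{1..n}. u < X i \<omega>})"
    by linarith
  moreover have "(\<Sum>i = 1..n. of_bool (X i \<omega> \<le> u)) = real (card {i\<in>{1..n}. X i \<omega> \<le> u})"
    by (simp add: of_bool_def sum.If_cases Int_def)
  ultimately show ?thesis
    using assms by (simp add: empirical_cdf_def field_simps)
qed

text \<open>A bounded supremum exceeds \<epsilon> iff some value does, so attainment is not an
  issue. A good \<open>u\<close> yields the level \<open>l = K u\<close>; conversely
  \<open>u\<close> is \<beta> or lies just far enough below \<open>c l\<close>.\<close>

lemma Sup_empirical_cdf_gt_iff:
  fixes X :: "nat \<Rightarrow> 'a \<Rightarrow> real" and U :: "real \<Rightarrow> real"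
  assumes n: "n \<ge> 1" and ab: "0 \<le> \<alpha>" "\<alpha> \<le> \<beta>" "\<beta> \<le> 1" and U: "\<And>u. u \<in> {0..1} \<Longrightarrow> U u = u"
  shows "(SUP u\<in>{\<alpha>..\<beta>}. empirical_cdf n X \<omega> u - U u) > \<epsilon> \<longleftrightarrow>
    (\<exists>l. \<alpha> < 1 - real l / real n - \<epsilon> \<and>
      card {i\<in>{1..n}. X i \<omega> \<in> exceedance_set \<beta> (1 - real l / real n - \<epsilon>)} \<le> l)"
    (is "_ \<longleftrightarrow> ?rhs")
proof -
  define K where "K u = card {i\<in>{1..n}. u < X i \<omega>}" for u
  define c where "c l = 1 - real l / real n - \<epsilon>" for l :: nat
  have diff: "empirical_cdf n X \<omega> u - U u = 1 - real (K u) / real n - u" if "u \<in> {\<alpha>..\<beta>}" for u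
    using that ab U[of u] by (simp add: empirical_cdf_eq[OF n] K_def)
  have "bdd_above ((\<lambda>u. empirical_cdf n X \<omega> u - U u) ` {\<alpha>..\<beta>})"
  proof (rule bdd_aboveI2)
    fix u assume u: "u \<in> {\<alpha>..\<beta>}"
    have "0 \<le> real (K u) / real n" by simp
    moreover have "0 \<le> u" using u ab by simp
    ultimately show "empirical_cdf n X \<omega> u - U u \<le> 1"
      unfolding diff[OF u] by linarith
  qed
  then have "(SUP u\<in>{\<alpha>..\<beta>}. empirical_cdf n X \<omega> u - U u) > \<epsilon> \<longleftrightarrow>
      (\<exists>u\<in>{\<alpha>..\<beta>}. empirical_cdf n X \<omega> u - U u > \<epsilon>)"
    using ab by (intro less_cSUP_iff) auto
  also have "\<dots> \<longleftrightarrow> (\<exists>u\<in>{\<alpha>..\<beta>}. u < c (K u))"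
    by (intro bex_cong refl) (auto simp: diff c_def)
  also have "\<dots> \<longleftrightarrow> (\<exists>l. \<alpha> < c l \<and> card {i\<in>{1..n}. X i \<omega> \<in> exceedance_set \<beta> (c l)} \<le> l)"
  proof
    assume "\<exists>u\<in>{\<alpha>..\<beta>}. u < c (K u)"
    then obtain u where u: "\<alpha> \<le> u" "u \<le> \<beta>" "u < c (K u)" by auto
    then have "card {i\<in>{1..n}. X i \<omega> \<in> exceedance_set \<beta> (c (K u))} \<le> K u"
      unfolding K_def by (intro card_mono) (auto simp: exceedance_set_def split: if_splits)
    with u show "\<exists>l. \<alpha> < c l \<and> card {i\<in>{1..n}. X i \<omega> \<in> exceedance_set \<beta> (c l)} \<le> l"
      by (intro exI[of _ "K u"]) auto
  next
    assume "\<exists>l. \<alpha> < c l \<and> card {i\<in>{1..n}. X i \<omega> \<in> exceedance_set \<beta> (c l)} \<le> l"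
    then obtain l where l: "\<alpha> < c l" "card {i\<in>{1..n}. X i \<omega> \<in> exceedance_set \<beta> (c l)} \<le> l" by blast
    \<comment> \<open>\<open>c\<close> is decreasing, so fewer exceedances only relax the bound on
      \<open>u\<close>.\<close>
    have K_le: "u < c (K u)" if "K u \<le> l" "u < c l" for u
    proof -
      have "c l \<le> c (K u)"
        using that(1) n by (simp add: c_def divide_right_mono)
      with that(2) show ?thesis by simp
    qed
    show "\<exists>u\<in>{\<alpha>..\<beta>}. u < c (K u)"
    proof (cases "\<beta> < c l")
      case True
      then have "K \<beta> \<le> l"
        using l(2) by (simp add: K_def exceedance_set_def)
      then show ?thesis
        using K_le[OF _ True] ab by (intro bexI[of _ \<beta>]) auto
    next
      case False
      \<comment> \<open>\<open>u\<close> is the largest sample below \<open>c l\<close>, or \<alpha>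
        if that is larger; every sample above \<open>u\<close> is then at least
        \<open>c l\<close>.\<close>
      define S where "S = insert \<alpha> ((\<lambda>i. X i \<omega>) ` {i\<in>{1..n}. X i \<omega> < c l})"
      define u where "u = Max S"
      have S: "finite S" "\<alpha> \<in> S" by (auto simp: S_def)
      then have "u \<in> S" unfolding u_def by (intro Max_in) auto
      then have u_less: "u < c l" using l(1) by (auto simp: S_def)
      have u_ge: "x \<le> u" if "x \<in> S" for x
        unfolding u_def using S(1) that by (rule Max_ge)
      have "K u \<le> card {i\<in>{1..n}. X i \<omega> \<in> exceedance_set \<beta> (c l)}"
        unfolding K_def
      proof (intro card_mono subsetI)
        fix i assume "i \<in> {i\<in>{1..n}. u < X i \<omega>}"
        then show "i \<in> {i\<in>{1..n}. X i \<omega> \<in> exceedance_set \<beta> (c l)}"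
          using u_ge[of "X i \<omega>"] False by (force simp: S_def exceedance_set_def)
      qed simp
      with l(2) K_le u_less have "u < c (K u)" by simp
      then show ?thesis
        using u_ge[OF S(2)] u_less False by (intro bexI[of _ u]) auto
    qed
  qed
  finally show ?thesis
    by (simp only: c_def)
qed

lemma prob_exceedance_set:
  fixes Y :: "'a \<Rightarrow> real"
  assumes Y: "Y \<in> borel_measurable M" and distr: "distr M borel Y = uniform_measure lborel {0..1}"
    and "0 \<le> c" "0 \<le> \<beta>" "c \<le> 1" "\<beta> \<le> 1"
  shows "\<P>(\<omega> in M. Y \<omega> \<in> exceedance_set \<beta> c) = 1 - min c \<beta>"
proof -
  let ?S = "exceedance_set \<beta> c"
  have "{\<omega>\<in>space M. Y \<omega> \<in> ?S} = Y -` ?S \<inter> space M" by auto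
  then have "\<P>(\<omega> in M. Y \<omega> \<in> ?S) = measure (distr M borel Y) ?S"
    using Y sets_exceedance_set by (simp add: measure_distr)
  also have "\<dots> = measure lborel ({0..1} \<inter> ?S)"
    unfolding distr using sets_exceedance_set by (simp add: measure_uniform_measure)
  also have "{0..1} \<inter> ?S = (if \<beta> < c then {\<beta><..1} else {c..1})"
    using assms by (auto simp: exceedance_set_def)
  also have "measure lborel \<dots> = 1 - min c \<beta>"
    using assms by auto
  finally show ?thesis .
qed

section \<open>From crossing probabilities to the closed formula\<close>

lemma sum_int_interval: "(\<Sum>l=int a..b - 1. f l) = (\<Sum>l=a..<nat b. f (int l))"
  by (rule sum.reindex_bij_witness[of _ int nat]) auto

text \<open>\<open>k0\<close> counts the levels \<open>l\<close> with
  \<open>\<beta> \<le> 1 - l / n - \<epsilon>\<close>, where the level is capped at \<beta>. It is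
  \<open>0\<close> when \<open>1 - \<beta> - \<epsilon>\<close> is negative, so one formula serves
  both signs.\<close>

lemma prob_Sup_empirical_cdf_gt:
  fixes M :: "'a measure" and X :: "nat \<Rightarrow> 'a \<Rightarrow> real" and n :: nat
    and \<alpha> \<beta> \<epsilon> :: real and U :: "real \<Rightarrow> real"
  assumes M: "prob_space M" and n: "n \<ge> 1" and iid: "iid_uniform01 M n X"
    and ab: "0 \<le> \<alpha>" "\<alpha> \<le> \<beta>" "\<beta> \<le> 1" and eps: "\<epsilon> > 0"
    and U: "\<And>u. u \<in> {0..1} \<Longrightarrow> U u = u"
  defines "k0 \<equiv> nat (\<lfloor>real n * (1 - \<beta> - \<epsilon>)\<rfloor> + 1)"
  shows "\<P>(\<omega> in M. (SUP u\<in>{\<alpha>..\<beta>}. empirical_cdf n X \<omega> u - U u) > \<epsilon>) =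
    (\<Sum>l<nat \<lceil>real n * (1 - \<alpha> - \<epsilon>)\<rceil>. real (n choose l) *
      (if l < k0 then \<beta> else 1 - real l / real n - \<epsilon>) ^ (n - l) *
      crossing_weight (1 / real n) (1 - \<beta>) (1 - \<beta> - \<epsilon>) k0 l)"
proof -
  interpret prob_space M by (rule M)
  define c where "c l = 1 - real l / real n - \<epsilon>" for l :: nat
  define N where "N = nat \<lceil>real n * (1 - \<alpha> - \<epsilon>)\<rceil>"
  have c_gt: "\<alpha> < c l \<longleftrightarrow> l < N" for l
  proof -
    have "\<alpha> < c l \<longleftrightarrow> real l < real n * (1 - \<alpha> - \<epsilon>)"
      using n by (simp add: c_def field_simps)
    also have "\<dots> \<longleftrightarrow> int l < \<lceil>real n * (1 - \<alpha> - \<epsilon>)\<rceil>"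
      by (simp add: less_ceiling_iff)
    also have "\<dots> \<longleftrightarrow> l < N"
      by (simp add: N_def zless_nat_eq_int_zless)
    finally show ?thesis .
  qed
  have event: "(SUP u\<in>{\<alpha>..\<beta>}. empirical_cdf n X \<omega> u - U u) > \<epsilon> \<longleftrightarrow>
      (\<exists>l<N. card {i\<in>{1..n}. X i \<omega> \<in> exceedance_set \<beta> (c l)} \<le> l)" for \<omega>
    unfolding c_gt[symmetric] c_def using n ab U by (rule Sup_empirical_cdf_gt_iff)
  show ?thesis
  \<comment> \<open>\<open>prob_crossing\<close> runs over \<open>l \<le> L\<close>, which requires
    \<open>N = Suc L\<close>. For \<open>N = 0\<close> no level exceeds \<alpha> and both sides
    vanish.\<close>
  proof (cases "N = 0")
    case True
    then show ?thesis
      unfolding event by (simp add: N_def)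
  next
    case False
    then obtain L where L: "N = Suc L" by (cases N) auto
    \<comment> \<open>The second branch equals \<open>l / n + \<epsilon>\<close>; it is kept in the
      shape \<open>b + l * z - c\<close> that \<open>crossing_weight_recursion\<close>
      expects.\<close>
    define v where "v l = (if l < k0 then 1 - \<beta> else 1 - \<beta> + real l * (1 / real n) - (1 - \<beta> - \<epsilon>))" for l
    have v_eq: "1 - v l = (if l < k0 then \<beta> else 1 - real l / real n - \<epsilon>)" for l
      by (simp add: v_def)
    have min_c: "min (c l) \<beta> = 1 - v l" for l
    proof -
      have "l < k0 \<longleftrightarrow> int l \<le> \<lfloor>real n * (1 - \<beta> - \<epsilon>)\<rfloor>"
        unfolding k0_def by linarith
      also have "\<dots> \<longleftrightarrow> real l \<le> real n * (1 - \<beta> - \<epsilon>)"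
        by (simp add: le_floor_iff)
      also have "\<dots> \<longleftrightarrow> \<beta> \<le> c l"
        using n by (simp add: c_def field_simps)
      finally show ?thesis
        by (auto simp: v_eq c_def)
    qed
    have "indep_vars (\<lambda>_. borel) X {1..n}"
      and distr: "distr M borel (X i) = uniform_measure lborel {0..1}" if "i \<in> {1..n}" for i
      using iid that by (auto simp: iid_uniform01_def)
    then have indep: "indep_vars (\<lambda>_. borel) X {1..n}"
      using iid by (simp add: iid_uniform01_def)
    have "\<P>(\<omega> in M. \<exists>l\<le>L. card {i\<in>{1..n}. X i \<omega> \<in> exceedance_set \<beta> (c l)} \<le> l) =
      (\<Sum>l\<le>L. of_nat (card {1..n} choose l) * (1 - v l) ^ (card {1..n} - l) *
        crossing_weight (1 / real n) (1 - \<beta>) (1 - \<beta> - \<epsilon>) k0 l)"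
    proof (rule prob_crossing[OF indep])
      have "c l' \<le> c l" if "l \<le> l'" for l l'
        using that by (simp add: c_def divide_right_mono)
      then show "mono (\<lambda>l. exceedance_set \<beta> (c l))"
        by (intro monoI antimonoD[OF antimono_exceedance_set])
      show "v l ^ l = (\<Sum>k\<le>l. of_nat (l choose k) * (v l - v k) ^ (l - k) *
          crossing_weight (1 / real n) (1 - \<beta>) (1 - \<beta> - \<epsilon>) k0 k)" for l
        unfolding v_def by (rule crossing_weight_recursion)
      fix i l assume i: "i \<in> {1..n}" and "l \<le> L"
      then have "\<alpha> < c l" using L by (simp add: c_gt)
      moreover have "c l \<le> 1"
        using eps divide_nonneg_nonneg[of "real l" "real n"] unfolding c_def by linarith
      ultimately have "\<P>(\<omega> in M. X i \<omega> \<in> exceedance_set \<beta> (c l)) = 1 - min (c l) \<beta>"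
        using i ab indep by (intro prob_exceedance_set distr) (auto simp: indep_vars_def)
      then show "\<P>(\<omega> in M. X i \<omega> \<in> exceedance_set \<beta> (c l)) = v l"
        by (simp add: min_c)
    qed (simp_all add: sets_exceedance_set)
    then show ?thesis
      unfolding event v_eq N_def[symmetric] L lessThan_Suc_atMost less_Suc_eq_le by simp
  qed
qed

text \<open>What remains is to expand \<open>crossing_weight\<close> and to pass to integer indices
  and exponents.\<close>

theorem theorem3:
  fixes M :: "'a measure" and X :: "nat \<Rightarrow> 'a \<Rightarrow> real" and n :: nat
    and \<alpha> \<beta> \<epsilon> n\<^sub>\<beta> :: real and nbar m :: int and U :: "real \<Rightarrow> real"
  assumes "prob_space M"
    and "n \<ge> 1"
    and "iid_uniform01 M n X"
    and "0 \<le> \<alpha>" and "\<alpha> \<le> \<beta>" and "\<beta> \<le> 1"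
    and "\<epsilon> > 0"
    and "\<And>u. u \<in> {0..1} \<Longrightarrow> U u = u"
    and "nbar = \<lceil>real n * (1 - \<alpha> - \<epsilon>)\<rceil>"
    and "n\<^sub>\<beta> = real n * (1 - \<beta> - \<epsilon>)"
    and "m = min (\<lfloor>n\<^sub>\<beta>\<rfloor> + 1) (nbar - 1)"
  shows
    "(n\<^sub>\<beta> > 0 \<longrightarrow>
       \<P>(\<omega> in M. (SUP u\<in>{\<alpha>..\<beta>}. empirical_cdf n X \<omega> u - U u) > \<epsilon>) =
         (\<Sum>l = 0..m. real (n choose nat l)
             * (min (1 - real_of_int l / real n - \<epsilon>) \<beta>) powi (int n - l) * (1 - \<beta>) powi l)
         + (\<Sum>l = m + 1..nbar - 1. real (n choose nat l)
             * (1 - real_of_int l / real n - \<epsilon>) powi (int n - l)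
             * (\<epsilon> * (real_of_int l / real n + \<epsilon>) powi (l - 1)
                + (\<Sum>j = 0..m - 1. (n\<^sub>\<beta> - real_of_int j) / real n * real (nat l choose nat j)
                     * ((real_of_int l - n\<^sub>\<beta>) / real n) powi (l - j - 1) * (1 - \<beta>) powi j)))) \<and>
     (n\<^sub>\<beta> < 0 \<longrightarrow>
       \<P>(\<omega> in M. (SUP u\<in>{\<alpha>..\<beta>}. empirical_cdf n X \<omega> u - U u) > \<epsilon>) =
         (\<Sum>l = 0..nbar - 1. real (n choose nat l)
             * (1 - real_of_int l / real n - \<epsilon>) powi (int n - l)
             * \<epsilon> * (real_of_int l / real n + \<epsilon>) powi (l - 1)))"
proof -
  define N where "N = nat nbar"
  define k0 where "k0 = nat (\<lfloor>n\<^sub>\<beta>\<rfloor> + 1)"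
  define q where "q = crossing_weight (1 / real n) (1 - \<beta>) (1 - \<beta> - \<epsilon>) k0"
  define P where "P = \<P>(\<omega> in M. (SUP u\<in>{\<alpha>..\<beta>}. empirical_cdf n X \<omega> u - U u) > \<epsilon>)"
  have n: "real n > 0" using assms(2) by simp
  have c: "1 - \<beta> - \<epsilon> = n\<^sub>\<beta> / real n"
    using n by (simp add: assms(10))
  have P: "P = (\<Sum>l<N. real (n choose l) * (if l < k0 then \<beta> else 1 - real l / real n - \<epsilon>) ^ (n - l) * q l)"
    unfolding P_def N_def q_def k0_def assms(9,10)
    using assms(1-8) by (rule prob_Sup_empirical_cdf_gt)
  \<comment> \<open>Keeps the exponents \<open>int n - l\<close> nonnegative, so that
    \<open>powi\<close> is an ordinary power.\<close>
  have le_n: "l \<le> n" if "l < N" for l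
  proof -
    have "int l < nbar" using that by (simp add: N_def)
    then have "real l < real n * (1 - \<alpha> - \<epsilon>)"
      by (simp add: assms(9) less_ceiling_iff)
    also have "\<dots> \<le> real n * 1"
      using assms(4,7) by (intro mult_left_mono) auto
    finally show ?thesis by simp
  qed
  have powi_n: "x powi (int n - int l) = x ^ (n - l)" if "l < N" for l and x :: real
    using le_n[OF that] by (simp flip: of_nat_diff)
  have abel_eps: "abel_term (1 / real n) l \<epsilon> = \<epsilon> * (real l / real n + \<epsilon>) powi (int l - 1)" for l
    using assms(7) by (subst abel_term_powi) (simp_all add: add.commute)
  have q_ge: "q l = \<epsilon> * (real l / real n + \<epsilon>) powi (int l - 1)
      + (\<Sum>j<k0. (n\<^sub>\<beta> - real j) / real n * real (l choose j)
           * ((real l - n\<^sub>\<beta>) / real n) powi (int l - int j - 1) * (1 - \<beta>) powi int j)"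
    if l: "k0 \<le> l" for l
  proof -
    \<comment> \<open>The first argument of the Abel term is minus
      \<open>(n\<^sub>\<beta> - j) / n\<close>, which turns the subtracted sum into an added one.
      Since \<open>j < k0 \<le> l\<close>, the exponent \<open>l - j - 1\<close> is
      nonnegative.\<close>
    have "real (l choose j) * (1 - \<beta>) ^ j * abel_term (1 / real n) (l - j) (real j * (1 / real n) - n\<^sub>\<beta> / real n) =
        - ((n\<^sub>\<beta> - real j) / real n * real (l choose j)
           * ((real l - n\<^sub>\<beta>) / real n) powi (int l - int j - 1) * (1 - \<beta>) powi int j)"
      if j: "j < k0" for j
    proof -
      obtain r where r: "l = Suc (j + r)"
        using less_imp_Suc_add[of j l] j l by auto
      have "real j * (1 / real n) - n\<^sub>\<beta> / real n + of_nat (Suc r) * (1 / real n) = (real l - n\<^sub>\<beta>) / real n"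
        by (simp add: r add_divide_distrib diff_divide_distrib)
      moreover have lj: "l - j = Suc r" by (simp add: r)
      ultimately have "abel_term (1 / real n) (l - j) (real j * (1 / real n) - n\<^sub>\<beta> / real n) =
          - ((n\<^sub>\<beta> - real j) / real n) * ((real l - n\<^sub>\<beta>) / real n) ^ r"
        unfolding lj abel_term.simps by (simp only:) (simp add: diff_divide_distrib)
      moreover have "int l - int j - 1 = int r" by (simp add: r)
      ultimately show ?thesis by simp
    qed
    then show ?thesis
      using l by (simp add: q_def crossing_weight_def c abel_eps[symmetric] sum_negf flip: c)
  qed
  show ?thesis
    unfolding P_def[symmetric]
  proof (intro conjI impI)
    assume pos: "n\<^sub>\<beta> > 0"
    have "n\<^sub>\<beta> \<le> real n * (1 - \<alpha> - \<epsilon>)"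
      unfolding assms(10) using assms(5) by (intro mult_left_mono) auto
    with pos have "nbar > 0" by (simp add: assms(9))
    then have N: "nbar = int N" "N > 0" by (simp_all add: N_def)
    have k0: "int k0 = \<lfloor>n\<^sub>\<beta>\<rfloor> + 1" "k0 > 0"
      using pos by (simp_all add: k0_def)
    define m' where "m' = min k0 (N - 1)"
    have m: "m = int m'"
      using N by (auto simp: m'_def assms(11) k0(1)[symmetric])
    have small: "l < k0 \<longleftrightarrow> real l \<le> n\<^sub>\<beta>" for l
    proof -
      have "l < k0 \<longleftrightarrow> int l \<le> \<lfloor>n\<^sub>\<beta>\<rfloor>" using k0(1) by linarith
      then show ?thesis by (simp add: le_floor_iff)
    qed
    have min_eq: "min (1 - real l / real n - \<epsilon>) \<beta> = (if l < k0 then \<beta> else 1 - real l / real n - \<epsilon>)" for l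
      using n unfolding small assms(10) by (auto simp: field_simps)
    \<comment> \<open>The simple form still holds at \<open>l = k0\<close>, so the first sum may
      include this index although the minimum there is no longer \<beta>.\<close>
    have q_le: "q l = (1 - \<beta>) ^ l" if "l \<le> k0" for l
    proof (cases "l = k0")
      case True
      then show ?thesis by (simp add: q_def crossing_weight_ge)
    next
      case False
      with that show ?thesis by (simp add: q_def crossing_weight_def)
    qed
    let ?f = "\<lambda>l. real (n choose l) * (if l < k0 then \<beta> else 1 - real l / real n - \<epsilon>) ^ (n - l) * q l"
    have "{..<N} = {0..<Suc m'} \<union> {Suc m'..<N}"
      using N(2) by (auto simp: m'_def)
    then have "P = (\<Sum>l=0..<Suc m'. ?f l) + (\<Sum>l=Suc m'..<N. ?f l)"
      unfolding P by (simp only:) (rule sum.union_disjoint; auto)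
    also have "(\<Sum>l=0..<Suc m'. ?f l) = (\<Sum>l = 0..m. real (n choose nat l)
             * (min (1 - real_of_int l / real n - \<epsilon>) \<beta>) powi (int n - l) * (1 - \<beta>) powi l)"
    proof -
      have full: "(\<Sum>l = 0..m. g l) = (\<Sum>l=0..<Suc m'. g (int l))" for g :: "int \<Rightarrow> real"
        using sum_int_interval[where a = 0 and b = "m + 1"] by (simp add: m nat_add_distrib del: sum.op_ivl_Suc)
      show ?thesis
        unfolding full
      proof (intro sum.cong refl)
        fix l assume "l \<in> {0..<Suc m'}"
        then have "l \<le> k0" "l < N" using N(2) by (auto simp: m'_def)
        then show "?f l = real (n choose nat (int l))
             * (min (1 - real_of_int (int l) / real n - \<epsilon>) \<beta>) powi (int n - int l) * (1 - \<beta>) powi int l"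
          by (simp add: powi_n min_eq q_le)
      qed
    qed
    also have "(\<Sum>l=Suc m'..<N. ?f l) = (\<Sum>l = m + 1..nbar - 1. real (n choose nat l)
             * (1 - real_of_int l / real n - \<epsilon>) powi (int n - l)
             * (\<epsilon> * (real_of_int l / real n + \<epsilon>) powi (l - 1)
                + (\<Sum>j = 0..m - 1. (n\<^sub>\<beta> - real_of_int j) / real n * real (nat l choose nat j)
                     * ((real_of_int l - n\<^sub>\<beta>) / real n) powi (l - j - 1) * (1 - \<beta>) powi j)))"
    proof -
      have inner: "(\<Sum>j = 0..m - 1. g j) = (\<Sum>j<m'. g (int j))" for g :: "int \<Rightarrow> real"
        using sum_int_interval[of g 0 m] by (simp add: m atLeast0LessThan)
      have outer: "(\<Sum>l = m + 1..nbar - 1. g l) = (\<Sum>l=Suc m'..<N. g (int l))" for g :: "int \<Rightarrow> real"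
        using sum_int_interval[of g "Suc m'" nbar] by (simp add: m N add.commute)
      show ?thesis
        unfolding outer inner
      proof (intro sum.cong refl)
        fix l assume "l \<in> {Suc m'..<N}"
        \<comment> \<open>If \<open>m'\<close> were \<open>N - 1\<close>, the range of
          \<open>l\<close> would be empty.\<close>
        then have "m' = k0" "k0 \<le> l" "\<not> l < k0" "l < N" by (auto simp: m'_def)
        then show "?f l = real (n choose nat (int l))
             * (1 - real_of_int (int l) / real n - \<epsilon>) powi (int n - int l)
             * (\<epsilon> * (real_of_int (int l) / real n + \<epsilon>) powi (int l - 1)
                + (\<Sum>j<m'. (n\<^sub>\<beta> - real_of_int (int j)) / real n * real (nat (int l) choose nat (int j))
                     * ((real_of_int (int l) - n\<^sub>\<beta>) / real n) powi (int l - int j - 1) * (1 - \<beta>) powi int j))"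
          by (simp add: powi_n q_ge)
      qed
    qed
    finally show "P = (\<Sum>l = 0..m. real (n choose nat l)
             * (min (1 - real_of_int l / real n - \<epsilon>) \<beta>) powi (int n - l) * (1 - \<beta>) powi l)
         + (\<Sum>l = m + 1..nbar - 1. real (n choose nat l)
             * (1 - real_of_int l / real n - \<epsilon>) powi (int n - l)
             * (\<epsilon> * (real_of_int l / real n + \<epsilon>) powi (l - 1)
                + (\<Sum>j = 0..m - 1. (n\<^sub>\<beta> - real_of_int j) / real n * real (nat l choose nat j)
                     * ((real_of_int l - n\<^sub>\<beta>) / real n) powi (l - j - 1) * (1 - \<beta>) powi j)))" .
  next
    assume "n\<^sub>\<beta> < 0"
    then have k0: "k0 = 0" unfolding k0_def by linarith
    show "P = (\<Sum>l = 0..nbar - 1. real (n choose nat l)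
             * (1 - real_of_int l / real n - \<epsilon>) powi (int n - l)
             * \<epsilon> * (real_of_int l / real n + \<epsilon>) powi (l - 1))"
    proof -
      \<comment> \<open>For \<open>nbar \<le> 0\<close> both sums are empty.\<close>
      have full: "(\<Sum>l = 0..nbar - 1. g l) = (\<Sum>l<N. g (int l))" for g :: "int \<Rightarrow> real"
        using sum_int_interval[where a = 0 and b = nbar] by (simp add: N_def atLeast0LessThan)
      show ?thesis
        unfolding P full by (intro sum.cong refl) (simp add: k0 q_ge powi_n)
    qed
  qed
qed

end
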